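(* Let $T\subset\mathbb{R}^n$ be discrete. Then there are no Voronoi cells of finite order with respect to $T$ that have dimension $n-1$ in $\mathbb{R}^n$; that is, there is no finite set $S\subset\mathbb{R}^n$ such that $V_T(S)$ is nonempty and $\dim V_T(S) = n-1$.
   Context: $n\geq 1$. For $S,T\subseteq\mathbb{R}^n$ the Voronoi cell of $S$ with respect to $T$ is $$V_T(S) := \left\{x\in\mathbb{R}^n : \sup_{s\in S}\|x-s\| \le \inf_{t\in T\setminus S}\|x-t\|\right\},$$ where $\|\cdot\|$ is the Euclidean norm; equivalently, for finite $S$, $x\in V_T(S)$ iff $\|x-s\|\le\|x-t\|$ for all $s\in S$, $t\in T\setminus S$ (with $\inf\emptyset=+\infty$). This is a convex set. When $S$ is finite, the order of the cell $V_T(S)$ is the cardinality $|S|$. A set $T\subset\mathbb{R}^n$ is called discrete if every bounded subset of $\mathbb{R}^n$ contains only finitely many points of $T$. The dimension $\dim$ of a nonempty convex set is the dimension of its affine hull. *)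

theory Defs
  imports "HOL-Analysis.Analysis"
begin

text \<open>
  Distances are embedded into the extended reals, so that the supremum over an empty \<open>S\<close> is
  \<open>-\<infinity>\<close>, the supremum over an unbounded \<open>S\<close> is \<open>\<infinity>\<close>, and the infimum over an empty
  \<open>T - S\<close> is \<open>\<infinity>\<close>. As in the source, \<open>S\<close> need not be a subset of \<open>T\<close>.
\<close>

definition voronoi_cell :: "(real ^ 'n) set \<Rightarrow> (real ^ 'n) set \<Rightarrow> (real ^ 'n) set"
  where "voronoi_cell T S =
    {x. (SUP s\<in>S. ereal (norm (x - s))) \<le> (INF t\<in>T - S. ereal (norm (x - t)))}"

text \<open>
  This is stronger than the library's \<^const>\<open>discrete\<close>, which only asks every point
  to be isolated and so allows accumulation points outside the set.
\<close>

definition boundedly_finite :: "(real ^ 'n) set \<Rightarrow> bool"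
  where "boundedly_finite T \<longleftrightarrow> (\<forall>B. bounded B \<longrightarrow> finite (T \<inter> B))"

end

theory Submission imports Defs begin

text \<open>
  Suppose that the cell \<open>C\<close> had dimension \<open>n - 1\<close>. It is convex, as an intersection of the
  half-spaces \<open>\<parallel>y - s\<parallel> \<le> \<parallel>y - t\<parallel>\<close>, so it has a relative interior point \<open>x\<close> inside its
  hyperplane, whose normal we call \<open>a\<close>. Only pairs \<open>(s, t)\<close> that are tight at \<open>x\<close>, meaning
  \<open>\<parallel>x - s\<parallel> = \<parallel>x - t\<parallel>\<close>, restrict \<open>C\<close> near \<open>x\<close>; this is where finiteness of \<open>S\<close> and bounded
  finiteness of \<open>T\<close> enter (\<open>eventually_nontight_pairs\<close>).

  Since \<open>C\<close> fills its hyperplane around \<open>x\<close>, every tight pair has \<open>s - t\<close> parallel to \<open>a\<close>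
  (\<open>tight_pair_parallel_normal\<close>). On the other hand, any two tight pairs share the same distance
  to \<open>x\<close>, because \<open>x\<close> separates the distances to \<open>S\<close> from those to \<open>T - S\<close>. Their four points
  therefore lie on one sphere around \<open>x\<close>; the mixed pairs are tight as well, so they also lie on
  one line parallel to \<open>a\<close>. A line meets a sphere in at most two points, whence the two pairs
  coincide (\<open>tight_pair_unique\<close>). With at most one tight pair, \<open>C\<close> is near \<open>x\<close> a half-space or
  everything, and one can leave the hyperplane from \<open>x\<close> inside \<open>C\<close>: a contradiction.
\<close>

lemma voronoi_cell_iff:
  "x \<in> voronoi_cell T S \<longleftrightarrow> (\<forall>s\<in>S. \<forall>t\<in>T - S. norm (x - s) \<le> norm (x - t))"
  unfolding voronoi_cell_def by (auto simp: SUP_le_iff le_INF_iff)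

lemma norm_le_norm_iff_halfspace:
  fixes x s t :: "'a::real_inner"
  shows "norm (x - s) \<le> norm (x - t) \<longleftrightarrow> (t - s) \<bullet> x \<le> (t \<bullet> t - s \<bullet> s) / 2"
  by (simp add: norm_le inner_diff inner_commute field_simps)

lemma convex_voronoi_cell: "convex (voronoi_cell T S)"
proof -
  have "voronoi_cell T S =
      (\<Inter>s\<in>S. \<Inter>t\<in>T - S. {x. (t - s) \<bullet> x \<le> (t \<bullet> t - s \<bullet> s) / 2})"
    by (auto simp: voronoi_cell_iff norm_le_norm_iff_halfspace)
  then show ?thesis
    by (simp only:) (intro convex_INT convex_halfspace_le)
qed

lemma norm_le_norm_translate_iff:
  fixes x w s t :: "'a::real_inner"
  assumes "norm (x - s) = norm (x - t)"
  shows "norm (x + w - s) \<le> norm (x + w - t) \<longleftrightarrow> 0 \<le> w \<bullet> (s - t)"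
  using assms by (simp add: norm_le norm_eq inner_diff inner_add inner_commute) linarith

text \<open>
  A pair that is not tight at \<open>x\<close> stays satisfied near \<open>x\<close> by continuity. To obtain one
  neighbourhood for all of them, split \<open>T\<close>: finitely many points lie within a fixed distance of
  \<open>x\<close>, and the others are so far away that no point near \<open>x\<close> can be closer to them than to \<open>S\<close>.
\<close>

lemma eventually_nontight_pairs:
  fixes x :: "real ^ 'n"
  assumes "boundedly_finite T" "finite S"
  shows "\<forall>\<^sub>F y in nhds x. \<forall>s\<in>S. \<forall>t\<in>T - S.
           norm (x - s) < norm (x - t) \<longrightarrow> norm (y - s) \<le> norm (y - t)"
proof (rule eventually_ball_finite[OF \<open>finite S\<close>], rule ballI)
  fix s
  \<comment> \<open>For \<open>y\<close> within distance 1 of \<open>x\<close>, its distance to \<open>s\<close> grows by at most 1 and its distance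
    to \<open>t\<close> shrinks by at most 1, so a margin of 2 suffices.\<close>
  define near where "near = (T - S) \<inter> cball x (norm (x - s) + 2)"
  have "finite near"
    using assms(1) unfolding boundedly_finite_def near_def
    by (rule_tac finite_subset[of _ "T \<inter> cball x (norm (x - s) + 2)"]) auto
  have near: "\<forall>\<^sub>F y in nhds x. \<forall>t\<in>near.
      norm (x - s) < norm (x - t) \<longrightarrow> norm (y - s) \<le> norm (y - t)"
  proof (rule eventually_ball_finite[OF \<open>finite near\<close>], rule ballI)
    fix t
    have "open {y. norm (y - s) < norm (y - t)}"
      by (intro open_Collect_less continuous_intros)
    then have "\<forall>\<^sub>F y in nhds x. norm (y - s) < norm (y - t)"
      if "norm (x - s) < norm (x - t)"
      using that by (auto simp: eventually_nhds)
    then show "\<forall>\<^sub>F y in nhds x. norm (x - s) < norm (x - t) \<longrightarrow> norm (y - s) \<le> norm (y - t)"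
      by (cases "norm (x - s) < norm (x - t)") (auto elim: eventually_mono)
  qed
  have "\<forall>\<^sub>F y in nhds x. dist y x < 1"
    by (auto simp: eventually_nhds_metric intro: exI[of _ 1])
  with near show "\<forall>\<^sub>F y in nhds x. \<forall>t\<in>T - S.
      norm (x - s) < norm (x - t) \<longrightarrow> norm (y - s) \<le> norm (y - t)"
  proof eventually_elim
    case (elim y)
    have "norm (y - s) \<le> norm (y - t)" if "t \<in> T - S" "t \<notin> near" for t
    proof -
      have "dist x s + 2 < dist x t"
        using that by (simp add: near_def dist_norm)
      moreover have "dist x t \<le> dist y x + dist y t" "dist y s \<le> dist y x + dist x s"
        by (rule dist_triangle3, rule dist_triangle)
      ultimately show ?thesis
        using elim(2) by (simp add: dist_norm)
    qed
    with elim(1) show ?case by blast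
  qed
qed

text \<open>
  Move from \<open>x\<close> against the projection \<open>p\<close> of \<open>s - t\<close> to the hyperplane. For a short step this stays
  in the cell, yet it decreases the inner product with \<open>s - t\<close> at the rate \<open>p \<bullet> p\<close>, which the
  tight half-space forbids unless \<open>p = 0\<close>.
\<close>

lemma tight_pair_parallel_normal:
  fixes x a :: "real ^ 'n"
  assumes x: "x \<in> rel_interior (voronoi_cell T S)"
    and hull: "affine hull (voronoi_cell T S) = {y. a \<bullet> y = b}"
    and st: "s \<in> S" "t \<in> T - S"
    and tight: "norm (x - s) = norm (x - t)"
    and "a \<noteq> 0"
  obtains c where "s - t = c *\<^sub>R a"
proof -
  define c where "c = (s - t) \<bullet> a / (a \<bullet> a)"
  define p where "p = (s - t) - c *\<^sub>R a"
  have pa: "p \<bullet> a = 0"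
    using \<open>a \<noteq> 0\<close> by (simp add: p_def c_def inner_diff_left)
  have "x \<in> affine hull (voronoi_cell T S)"
    using x by (simp add: mem_rel_interior_cball hull_inc)
  obtain e where e: "e > 0"
    "cball x e \<inter> affine hull (voronoi_cell T S) \<subseteq> voronoi_cell T S"
    using x by (auto simp: mem_rel_interior_cball)
  \<comment> \<open>The summand 1 keeps the quotient meaningful while \<open>p = 0\<close> is still possible.\<close>
  define k where "k = e / (1 + norm p)"
  have pos: "0 < 1 + norm p"
    by (simp add: add_pos_nonneg)
  then have "k > 0"
    using e(1) by (simp add: k_def)
  have "k * norm p \<le> e"
    using e(1) pos by (simp add: k_def pos_divide_le_eq distrib_left)
  then have "x + (- k) *\<^sub>R p \<in> cball x e"
    using \<open>k > 0\<close> by (simp add: dist_norm)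
  moreover have "x + (- k) *\<^sub>R p \<in> affine hull (voronoi_cell T S)"
    using \<open>x \<in> affine hull _\<close> pa unfolding hull
    by (simp add: inner_diff_right inner_commute)
  ultimately have "x + (- k) *\<^sub>R p \<in> voronoi_cell T S"
    using e(2) by blast
  then have "0 \<le> ((- k) *\<^sub>R p) \<bullet> (s - t)"
    using st norm_le_norm_translate_iff[OF tight] unfolding voronoi_cell_iff by blast
  moreover have "p \<bullet> (s - t) = p \<bullet> p"
    using pa by (simp add: p_def inner_diff_right)
  ultimately have "p \<bullet> p \<le> 0"
    using \<open>k > 0\<close> by (simp add: mult_le_0_iff)
  then have "p = 0"
    using inner_eq_zero_iff[of p] inner_ge_zero[of p] by linarith
  then have "s - t = c *\<^sub>R a"
    by (simp add: p_def)
  then show thesis ..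
qed

text \<open>
  Along the line \<open>p - k *\<^sub>R a\<close>, meeting the sphere around \<open>x\<close> through \<open>p\<close> is a quadratic equation in
  \<open>k\<close> with root \<open>0\<close>; dividing by \<open>k\<close> leaves a linear equation, hence a single other root.
\<close>

lemma line_sphere_second_point_unique:
  fixes x a p q r :: "'a::real_inner"
  assumes "norm (x - p) = norm (x - q)" "norm (x - p) = norm (x - r)"
    and q: "p - q = c *\<^sub>R a" "p \<noteq> q" and r: "p - r = d *\<^sub>R a" "p \<noteq> r"
  shows "q = r"
proof -
  have root: "2 * ((x - p) \<bullet> a) = - k * (a \<bullet> a)"
    if eq: "norm (x - p) = norm (x - z)" and z: "p - z = k *\<^sub>R a" and "p \<noteq> z" for z k
  proof -
    define u where "u = x - p"
    have "x - z = u + k *\<^sub>R a"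
      using z by (simp add: u_def algebra_simps)
    with eq have "(u + k *\<^sub>R a) \<bullet> (u + k *\<^sub>R a) = u \<bullet> u"
      by (simp add: norm_eq u_def)
    then have "k * (2 * (u \<bullet> a) + k * (a \<bullet> a)) = 0"
      by (simp add: inner_add_left inner_add_right inner_commute distrib_left)
    then show ?thesis
      using z \<open>p \<noteq> z\<close> by (auto simp: u_def)
  qed
  have "c * (a \<bullet> a) = d * (a \<bullet> a)"
    using root[OF assms(1) q] root[OF assms(2) r] by linarith
  then have "c = d"
    using q by auto
  with q r have "p - q = p - r" by simp
  then show ?thesis by simp
qed

text \<open>
  The mixed pairs \<open>(s, t')\<close> and \<open>(s', t)\<close> are the key: \<open>\<parallel>x - s\<parallel> \<le> \<parallel>x - t'\<parallel> = \<parallel>x - s'\<parallel> \<le> \<parallel>x - t\<parallel> = \<parallel>x - s\<parallel>\<close>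
  forces equality throughout. Then \<open>t\<close> and \<open>t'\<close> are both the second point of the normal line
  through \<open>s\<close> on the sphere, and \<open>s\<close> and \<open>s'\<close> both the second one of the line through \<open>t\<close>.
\<close>

lemma tight_pair_unique:
  fixes x a :: "real ^ 'n"
  assumes x: "x \<in> rel_interior (voronoi_cell T S)"
    and hull: "affine hull (voronoi_cell T S) = {y. a \<bullet> y = b}" "a \<noteq> 0"
    and st: "s \<in> S" "t \<in> T - S" "norm (x - s) = norm (x - t)"
    and st': "s' \<in> S" "t' \<in> T - S" "norm (x - s') = norm (x - t')"
  shows "s = s' \<and> t = t'"
proof -
  have "x \<in> voronoi_cell T S"
    using x rel_interior_subset by blast
  then have "norm (x - s) \<le> norm (x - t')" "norm (x - s') \<le> norm (x - t)"
    using st st' unfolding voronoi_cell_iff by blast+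
  then have mixed: "norm (x - s) = norm (x - t')" "norm (x - s') = norm (x - t)"
    using st st' by auto
  note parallel = tight_pair_parallel_normal[OF x hull(1) _ _ _ hull(2)]
  obtain c where c: "s - t = c *\<^sub>R a" using parallel[OF st] .
  obtain d where d: "s - t' = d *\<^sub>R a" using parallel[OF st(1) st'(2) mixed(1)] .
  obtain e where e: "s' - t = e *\<^sub>R a" using parallel[OF st'(1) st(2) mixed(2)] .
  have "t = t'"
    by (rule line_sphere_second_point_unique[OF st(3) mixed(1) c _ d]) (use st st' in auto)
  moreover have on_line: "t - s = (- c) *\<^sub>R a" "t - s' = (- e) *\<^sub>R a"
    using c e by (simp_all add: algebra_simps)
  have "s = s'"
    by (rule line_sphere_second_point_unique[OF st(3)[symmetric] mixed(2)[symmetric]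
          on_line(1) _ on_line(2)]) (use st st' in auto)
  ultimately show ?thesis by simp
qed

theorem corollary3p4:
  fixes T :: "(real ^ 'n) set"
  assumes "boundedly_finite T"
  shows "\<not> (\<exists>S :: (real ^ 'n) set. finite S \<and> voronoi_cell T S \<noteq> {} \<and>
            aff_dim (voronoi_cell T S) = int CARD('n) - 1)"
proof
  assume "\<exists>S :: (real ^ 'n) set. finite S \<and> voronoi_cell T S \<noteq> {} \<and>
            aff_dim (voronoi_cell T S) = int CARD('n) - 1"
  then obtain S :: "(real ^ 'n) set" where S: "finite S" "voronoi_cell T S \<noteq> {}"
    "aff_dim (voronoi_cell T S) = int CARD('n) - 1" by blast
  obtain a b where "a \<noteq> 0" and hull: "affine hull (voronoi_cell T S) = {y. a \<bullet> y = b}"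
    using S(3) aff_dim_eq_hyperplane[of "voronoi_cell T S"] by auto
  obtain x where x: "x \<in> rel_interior (voronoi_cell T S)"
    using S(2) convex_voronoi_cell rel_interior_eq_empty by blast
  have xC: "x \<in> voronoi_cell T S"
    using x rel_interior_subset by blast
  let ?tight = "\<lambda>s t. s \<in> S \<and> t \<in> T - S \<and> norm (x - s) = norm (x - t)"
  \<comment> \<open>A direction transversal to the hyperplane that respects every tight pair: towards \<open>s\<close> when
    \<open>(s, t)\<close> is the only one, and any direction when there is none.\<close>
  obtain v where v: "a \<bullet> v \<noteq> 0" "\<And>s t. ?tight s t \<Longrightarrow> 0 \<le> v \<bullet> (s - t)"
  proof (cases "\<exists>s t. ?tight s t")
    case True
    then obtain s t where st: "s \<in> S" "t \<in> T - S" "norm (x - s) = norm (x - t)" by blast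
    obtain c where c: "s - t = c *\<^sub>R a"
      using tight_pair_parallel_normal[OF x hull st \<open>a \<noteq> 0\<close>] .
    have "a \<bullet> (s - t) \<noteq> 0"
      using c st \<open>a \<noteq> 0\<close> by auto
    moreover have "0 \<le> (s - t) \<bullet> (s' - t')" if "?tight s' t'" for s' t'
      using tight_pair_unique[OF x hull \<open>a \<noteq> 0\<close> st, of s' t'] that by auto
    ultimately show thesis by (rule that)
  next
    case False
    then show thesis using \<open>a \<noteq> 0\<close> by (intro that[of a]) auto
  qed
  have "((\<lambda>k. x + k *\<^sub>R v) \<longlongrightarrow> x + 0 *\<^sub>R v) (at_right 0)"
    by (intro tendsto_intros)
  then have "filterlim (\<lambda>k. x + k *\<^sub>R v) (nhds x) (at_right 0)"
    by simp
  then have "\<forall>\<^sub>F k in at_right 0. \<forall>s\<in>S. \<forall>t\<in>T - S. norm (x - s) < norm (x - t) \<longrightarrow>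
      norm (x + k *\<^sub>R v - s) \<le> norm (x + k *\<^sub>R v - t)"
    by (rule eventually_compose_filterlim[OF eventually_nontight_pairs[OF assms S(1)]])
  moreover have "\<forall>\<^sub>F k in at_right (0::real). 0 < k"
    by (rule eventually_at_right_less)
  ultimately have "\<forall>\<^sub>F k in at_right 0. 0 < k \<and> x + k *\<^sub>R v \<in> voronoi_cell T S"
  proof eventually_elim
    case (elim k)
    have "norm (x + k *\<^sub>R v - s) \<le> norm (x + k *\<^sub>R v - t)" if "s \<in> S" "t \<in> T - S" for s t
    proof (cases "norm (x - s) = norm (x - t)")
      case True
      then show ?thesis
        using v(2)[of s t] that elim(2) by (simp add: norm_le_norm_translate_iff)
    next
      case False
      moreover have "norm (x - s) \<le> norm (x - t)"
        using xC that unfolding voronoi_cell_iff by blast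
      ultimately show ?thesis
        using elim(1) that by force
    qed
    then show ?case
      using elim(2) unfolding voronoi_cell_iff by blast
  qed
  then obtain k where k: "0 < k" "x + k *\<^sub>R v \<in> voronoi_cell T S"
    using eventually_happens by force
  have "a \<bullet> x = b" "a \<bullet> (x + k *\<^sub>R v) = b"
    using xC k(2) hull hull_subset[of "voronoi_cell T S" affine] by auto
  then show False
    using k(1) v(1) by (simp add: inner_add_right)
qed

end
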